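(* Let $n\ge1$ be an integer. Let $g$ be a positive, extended real-valued, even function defined on $\mathbb{R}$ that is periodic with period $2\pi$ and satisfies $g(0)=\lim_{t\to0}g(t)$. Suppose further that $g$ is non-increasing and strictly convex on $(0,\pi]$. For $\omega_n=(t_1,\ldots,t_n)\in\Omega_n$ put $P_{\omega_n}(t):=\sum_{j=1}^n g(t-t_j)$. Then $$\min_{\omega_n\in\Omega_n}\left\{\max_{1\le j\le n}\left\{\min_{t\in[t_j,t_{j+1}]}P_{\omega_n}(t)\right\}\right\}=P_{\widetilde\omega_n}(\pi/n);$$ that is, the solution to this min-max-min problem is given by $n$ distinct equally spaced points $e^{it_1},\ldots,e^{it_n}$ on the unit circle, and, moreover, these are the only solutions.
   Context: $\Omega_n$ denotes the collection of all $n$-tuples $\omega_n=(t_1,\ldots,t_n)\in[0,2\pi)^n$ with $0\le t_1\le\cdots\le t_n<2\pi$ (coincident points are allowed), and $t_{n+1}:=t_1+2\pi$. The equally spaced configuration $\widetilde\omega_n=(\widetilde t_1,\ldots,\widetilde t_n)\in\Omega_n$ is given by $\widetilde t_j:=2(j-1)\pi/n$, $j=1,\ldots,n$. The value $g(0)$ may be $+\infty$. *)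

theory Defs
  imports "HOL-Analysis.Analysis"
begin

text \<open>The library's \<^const>\<open>convex_on\<close> is non-strict and for real-valued functions only.  Because of the
  strict inequality, a function with values in \<open>(0, \<infinity>]\<close> that satisfies the following on an interval is
  finite in the interior of that interval.\<close>

definition strictly_convex_on :: "real set \<Rightarrow> (real \<Rightarrow> ereal) \<Rightarrow> bool" where
  "strictly_convex_on S f \<longleftrightarrow> convex S \<and>
     (\<forall>x\<in>S. \<forall>y\<in>S. x \<noteq> y \<longrightarrow> (\<forall>u. 0 < u \<and> u < 1 \<longrightarrow>
        f ((1 - u) * x + u * y) < ereal (1 - u) * f x + ereal u * f y))"

text \<open>An $n$-tuple \<open>(t\<^sub>1, \<dots>, t\<^sub>n)\<close> is an extensional function on the index set \<open>{1..n}\<close>.\<close>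

definition Omega :: "nat \<Rightarrow> (nat \<Rightarrow> real) set" where
  "Omega n = {t \<in> {1..n} \<rightarrow>\<^sub>E {0..<2 * pi}. mono_on {1..n} t}"

definition next_point :: "nat \<Rightarrow> (nat \<Rightarrow> real) \<Rightarrow> nat \<Rightarrow> real" where
  "next_point n t j = (if j = n then t 1 + 2 * pi else t (j + 1))"

definition potential :: "(real \<Rightarrow> ereal) \<Rightarrow> nat \<Rightarrow> (nat \<Rightarrow> real) \<Rightarrow> real \<Rightarrow> ereal" where
  "potential g n t s = (\<Sum>j = 1..n. g (s - t j))"

definition arc_min :: "(real \<Rightarrow> ereal) \<Rightarrow> nat \<Rightarrow> (nat \<Rightarrow> real) \<Rightarrow> nat \<Rightarrow> ereal" where
  "arc_min g n t j = (INF s\<in>{t j..next_point n t j}. potential g n t s)"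

definition max_arc_min :: "(real \<Rightarrow> ereal) \<Rightarrow> nat \<Rightarrow> (nat \<Rightarrow> real) \<Rightarrow> ereal" where
  "max_arc_min g n t = Max (arc_min g n t ` {1..n})"

definition equispaced :: "nat \<Rightarrow> nat \<Rightarrow> real" where
  "equispaced n = (\<lambda>j\<in>{1..n}. 2 * (real j - 1) * pi / real n)"

text \<open>The points \<open>e\<^sup>i\<^sup>t\<close>, for \<open>t\<close> running through the tuple, are the vertices of a regular $n$-gon
  inscribed in the unit circle, in an arbitrary rotated position.\<close>

definition distinct_equally_spaced :: "nat \<Rightarrow> (nat \<Rightarrow> real) \<Rightarrow> bool" where
  "distinct_equally_spaced n t \<longleftrightarrow> inj_on (\<lambda>j. cis (t j)) {1..n} \<and>
     (\<exists>\<alpha>. (\<lambda>j. cis (t j)) ` {1..n} = (\<lambda>k. cis (\<alpha> + 2 * pi * real k / real n)) ` {..<n})"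

end

theory Submission
  imports Defs
begin

text \<open>Continued by symmetry, \<open>g\<close> is strictly convex on \<open>(0, 2\<pi>)\<close>, so at each node
  \<open>m\<^sub>i = (2 i - 1) \<pi> / n\<close> its graph lies above a tangent line of slope \<open>c\<^sub>i\<close>, and the slopes can be
  chosen antisymmetric about \<open>\<pi>\<close>, so that they sum to 0.  Seen from a point \<open>s\<close> of the \<open>j\<close>-th arc,
  the configuration is \<open>t\<^bsub>j+1\<^esub> - s, \<dots>, t\<^bsub>j+n\<^esub> - s\<close> in \<open>[0, 2\<pi>]\<close>.  Adding up the tangent
  inequalities bounds the potential at \<open>s\<close> from below by \<open>\<Sum>\<^sub>i g(m\<^sub>i)\<close>, which is the value of the
  equally spaced configuration, plus \<open>\<Sum>\<^sub>i c\<^sub>i (t\<^bsub>j+i\<^esub> - m\<^sub>i)\<close>.  The latter does not depend on \<open>s\<close>, and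
  its average over \<open>j\<close> is 0; hence it is nonnegative for some arc.  By strict convexity, equality
  forces \<open>t\<^bsub>j+i\<^esub> - s = m\<^sub>i\<close> for all \<open>i\<close>.\<close>

section \<open>Finite sums: cyclic shifts and strict comparison in \<open>ereal\<close>\<close>

text \<open>Raising \<open>m\<close> by one trades the first summand for the one a period later.
  Periodicity is assumed only up to \<open>m\<close> because \<open>lift\<close> is meaningful only
  up to index \<open>2 * n\<close>.\<close>

lemma sum_cyclic_shift:
  fixes h :: "nat \<Rightarrow> 'a::comm_monoid_add"
  assumes "n \<ge> 1" and "\<And>k. 1 \<le> k \<Longrightarrow> k \<le> m \<Longrightarrow> h (k + n) = h k"
  shows "(\<Sum>i=1..n. h (m + i)) = (\<Sum>i=1..n. h i)"
  using assms(2)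
proof (induction m)
  case 0
  show ?case by simp
next
  case (Suc m)
  obtain n' where n': "n = Suc n'" using \<open>n \<ge> 1\<close> by (cases n) auto
  have "(\<Sum>i=1..n. h (Suc m + i)) = (\<Sum>i=1..n'. h (Suc m + i)) + h (Suc m + n)"
    unfolding n' by simp
  also have "h (Suc m + n) = h (Suc m)" using Suc.prems[of "Suc m"] by simp
  also have "(\<Sum>i=1..n'. h (Suc m + i)) + h (Suc m) = (\<Sum>i=1..n. h (m + i))"
    unfolding n'
    by (subst (2) sum.atLeast_Suc_atMost)
      (simp_all add: sum.shift_bounds_cl_Suc_ivl add.commute del: sum.cl_ivl_Suc)
  also have "\<dots> = (\<Sum>i=1..n. h i)" using Suc by simp
  finally show ?case .
qed

text \<open>The lower bounds are real, so one strict summand makes the sum strict even when other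
  terms are infinite.\<close>

lemma sum_ereal_strict_mono:
  fixes f :: "'a \<Rightarrow> ereal" and b :: "'a \<Rightarrow> real"
  assumes "finite A" and le: "\<And>i. i \<in> A \<Longrightarrow> ereal (b i) \<le> f i"
    and i: "i \<in> A" "ereal (b i) < f i"
  shows "ereal (\<Sum>i\<in>A. b i) < (\<Sum>i\<in>A. f i)"
proof -
  have "ereal (\<Sum>k\<in>A - {i}. b k) \<le> (\<Sum>k\<in>A - {i}. f k)"
    unfolding sum_ereal[symmetric] by (rule sum_mono) (use le in auto)
  moreover have "(\<Sum>k\<in>A. b k) = b i + (\<Sum>k\<in>A - {i}. b k)"
    "(\<Sum>k\<in>A. f k) = f i + (\<Sum>k\<in>A - {i}. f k)"
    by (rule sum.remove[OF assms(1) i(1)])+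
  moreover have "ereal (x + y) < v + w" if "ereal x < v" "ereal y \<le> w" for x y v w
    using that by (cases v; cases w) auto
  ultimately show ?thesis using i(2) by metis
qed

text \<open>\<open>lift n t\<close> continues the tuple past \<open>t n\<close> by one turn; it is meaningful on \<open>{1..2 * n}\<close> only.\<close>

definition lift :: "nat \<Rightarrow> (nat \<Rightarrow> real) \<Rightarrow> nat \<Rightarrow> real" where
  "lift n t k = (if k \<le> n then t k else t (k - n) + 2 * pi)"

text \<open>The odd multiples of \<open>pi / n\<close>: the positions of equally spaced points as
  seen from the midpoint between two neighbours.\<close>

definition node :: "nat \<Rightarrow> nat \<Rightarrow> real" where
  "node n i = (2 * real i - 1) * pi / real n"

section \<open>Ranges of tuples, nodes and lifted points\<close>

lemma OmegaD:
  assumes "t \<in> Omega n" "j \<in> {1..n}"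
  shows "0 \<le> t j" "t j < 2 * pi" "\<And>k. k \<in> {1..n} \<Longrightarrow> j \<le> k \<Longrightarrow> t j \<le> t k"
  using assms by (auto simp: Omega_def PiE_iff mono_on_def)

lemma next_point_ge:
  assumes "t \<in> Omega n" "j \<in> {1..n}"
  shows "t j \<le> next_point n t j"
proof (cases "j = n")
  case True
  then show ?thesis
    using OmegaD[OF assms] OmegaD[OF assms(1), of 1] assms(2) by (simp add: next_point_def)
next
  case False
  then show ?thesis
    using OmegaD(3)[OF assms, of "j + 1"] assms(2) by (simp add: next_point_def)
qed

lemma node_range:
  assumes "i \<in> {1..n}"
  shows "node n i \<in> {0<..<2*pi}"
proof -
  have "(2 * real i - 1) * pi < (2 * real n) * pi"
    using assms by (intro mult_strict_right_mono) auto
  then show ?thesis using assms by (auto simp: node_def field_simps)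
qed

text \<open>Reflection about \<open>pi\<close> permutes the nodes, so slopes antisymmetric about
  \<open>pi\<close> cancel when summed over them.\<close>

lemma node_reflect:
  assumes "i \<in> {1..n}"
  shows "node n (n + 1 - i) = 2 * pi - node n i"
  using assms by (simp add: node_def of_nat_diff field_simps)

text \<open>The lifted points with indices \<open>j + 1\<close> to \<open>j + n\<close> lie between
  \<open>next_point n t j\<close> and \<open>t j + 2 * pi\<close>. Both ends \<open>0\<close> and
  \<open>2 * pi\<close> can occur, so the tangent bounds have to cover the points where
  \<open>g\<close> may be infinite.\<close>

lemma lift_range:
  assumes t: "t \<in> Omega n" and j: "j \<in> {1..n}" and i: "i \<in> {1..n}"
    and s: "s \<in> {t j..next_point n t j}"
  shows "lift n t (j + i) - s \<in> {0..2*pi}"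
proof (cases "j + i \<le> n")
  case True
  then have "t (j + 1) \<le> t (j + i)" "t (j + i) < 2 * pi" "0 \<le> t j"
    using OmegaD[OF t, of "j + 1"] OmegaD[OF t, of "j + i"] OmegaD[OF t j] i by auto
  then show ?thesis
    using s True i by (auto simp: lift_def next_point_def)
next
  case False
  then have k: "j + i - n \<in> {1..n}" using i j by auto
  then have "t (j + i - n) \<le> t j" "0 \<le> t (j + i - n)"
    using OmegaD[OF t k] j i by auto
  moreover have "next_point n t j \<le> t (j + i - n) + 2 * pi"
  proof (cases "j = n")
    case True
    then show ?thesis using OmegaD(3)[OF t, of 1 i] i by (simp add: next_point_def)
  next
    case False
    then show ?thesis
      using OmegaD(2)[OF t, of "j + 1"] j \<open>0 \<le> t (j + i - n)\<close> by (simp add: next_point_def)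
  qed
  ultimately show ?thesis using s False by (auto simp: lift_def)
qed

section \<open>Regular polygons on the circle\<close>

lemma inj_on_regular:
  assumes "n \<ge> 1"
  shows "inj_on (\<lambda>k. cis (\<alpha> + 2 * pi * real k / real n)) {..<n}"
proof -
  have "inj_on (\<lambda>k. cis (2 * pi * real k / real n)) {..<n}"
    using Complex.bij_betw_roots_unity[of n] assms by (simp add: bij_betw_def)
  then show ?thesis by (simp add: inj_on_def flip: cis_mult)
qed

text \<open>By counting: \<open>n\<close> distinct vertices covered by at most \<open>n\<close>
  points leave room neither for further points nor for coincidences.\<close>

lemma distinct_equally_spacedI:
  assumes "n \<ge> 1"
    and sub: "\<And>k. k < n \<Longrightarrow> cis (\<alpha> + 2 * pi * real k / real n) \<in> (\<lambda>j. cis (t j)) ` {1..n}"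
  shows "distinct_equally_spaced n t"
proof -
  let ?R = "(\<lambda>k. cis (\<alpha> + 2 * pi * real k / real n)) ` {..<n}"
  let ?T = "(\<lambda>j. cis (t j)) ` {1..n}"
  have card: "card ?R = n" using card_image[OF inj_on_regular[OF assms(1), of \<alpha>]] by simp
  have "?R \<subseteq> ?T" using sub by auto
  moreover have "card ?T \<le> n" using card_image_le[of "{1..n}" "\<lambda>j. cis (t j)"] by simp
  ultimately have "?T = ?R" using card by (intro card_seteq[symmetric]) auto
  moreover from this have "inj_on (\<lambda>j. cis (t j)) {1..n}"
    using card by (intro eq_card_imp_inj_on) auto
  ultimately show ?thesis unfolding distinct_equally_spaced_def by blast
qed

lemma equispaced_distinct_equally_spaced:
  assumes "n \<ge> 1"
  shows "distinct_equally_spaced n (equispaced n)"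
proof (rule distinct_equally_spacedI[OF assms, of 0])
  fix k assume "k < n"
  then show "cis (0 + 2 * pi * real k / real n) \<in> (\<lambda>j. cis (equispaced n j)) ` {1..n}"
    by (intro image_eqI[where x = "Suc k"]) (auto simp: equispaced_def mult_ac)
qed

lemma equispaced_Omega: "equispaced n \<in> Omega n"
proof -
  have "2 * (real j - 1) * pi / real n < 2 * pi" if "j \<in> {1..n}" for j
  proof -
    have "(2 * (real j - 1)) * pi < (2 * real n) * pi"
      using that by (intro mult_strict_right_mono) auto
    then show ?thesis using that by (simp add: field_simps)
  qed
  then show ?thesis
    by (auto simp: Omega_def equispaced_def mono_on_def divide_right_mono)
qed

text \<open>Numbers the vertices by a bijection, so that a sum over the tuple becomes a sum over the
  vertices.\<close>

lemma distinct_equally_spacedE: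
  assumes "distinct_equally_spaced n t"
  obtains \<alpha> \<kappa> where "bij_betw \<kappa> {1..n} {..<n}"
    "\<And>j. j \<in> {1..n} \<Longrightarrow> cis (t j) = cis (\<alpha> + 2 * pi * real (\<kappa> j) / real n)"
proof -
  obtain \<alpha> where inj: "inj_on (\<lambda>j. cis (t j)) {1..n}"
    and im: "(\<lambda>j. cis (t j)) ` {1..n} = (\<lambda>k. cis (\<alpha> + 2 * pi * real k / real n)) ` {..<n}"
    using assms unfolding distinct_equally_spaced_def by blast
  have "\<forall>j\<in>{1..n}. \<exists>k<n. cis (t j) = cis (\<alpha> + 2 * pi * real k / real n)"
    using im by blast
  then obtain \<kappa> where \<kappa>: "\<And>j. j \<in> {1..n} \<Longrightarrow> \<kappa> j < n"
    "\<And>j. j \<in> {1..n} \<Longrightarrow> cis (t j) = cis (\<alpha> + 2 * pi * real (\<kappa> j) / real n)"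
    by metis
  have "inj_on \<kappa> {1..n}"
    using inj \<kappa>(2) unfolding inj_on_def by metis
  moreover from this have "\<kappa> ` {1..n} = {..<n}"
    using \<kappa>(1) by (intro card_subset_eq) (auto simp: card_image)
  ultimately show ?thesis using \<kappa>(2) by (intro that[of \<kappa> \<alpha>]) (auto simp: bij_betw_def)
qed

text \<open>The arc length is a multiple of \<open>2 * pi / n\<close>, nonnegative by monotonicity
  and nonzero by distinctness, hence at least \<open>2 * pi / n\<close>.\<close>

lemma regular_arc_midpoint:
  assumes "n \<ge> 1" and t: "t \<in> Omega n" and reg: "distinct_equally_spaced n t" and j: "j \<in> {1..n}"
  shows "t j + pi / real n \<in> {t j..next_point n t j}"
\<comment> \<open>For \<open>n = 1\<close> both ends of the arc are the same point of the circle, so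
  distinctness says nothing; the arc is then a full turn.\<close>
proof (cases "n = 1")
  case True
  then show ?thesis using j by (simp add: next_point_def)
next
  case False
  define j' where "j' = (if j = n then 1 else j + 1)"
  have j': "j' \<in> {1..n}" "j' \<noteq> j" using j False by (auto simp: j'_def)
  obtain \<alpha> \<kappa> where \<kappa>: "\<And>j. j \<in> {1..n} \<Longrightarrow> cis (t j) = cis (\<alpha> + 2 * pi * real (\<kappa> j) / real n)"
    using distinct_equally_spacedE[OF reg] by metis
  have cis_next: "cis (next_point n t j) = cis (t j')"
    by (simp add: next_point_def j'_def flip: cis_mult)
  have period: "\<exists>a::int. x = y + 2 * pi * a" if "cis x = cis y" for x y
    using that sin_cos_eq_iff[of x y] by (simp add: complex_eq_iff)
  obtain a :: int where a: "next_point n t j = \<alpha> + 2 * pi * real (\<kappa> j') / real n + 2 * pi * a"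
    using period[OF cis_next[unfolded \<kappa>[OF j'(1)]]] by blast
  obtain b :: int where b: "t j = \<alpha> + 2 * pi * real (\<kappa> j) / real n + 2 * pi * b"
    using period[OF \<kappa>[OF j]] by blast
  \<comment> \<open>The arc length in units of \<open>2 * pi / n\<close>.\<close>
  define m :: int where "m = int (\<kappa> j') - int (\<kappa> j) + int n * (a - b)"
  have m: "next_point n t j - t j = 2 * pi * of_int m / real n"
    using \<open>n \<ge> 1\<close> unfolding a b m_def by (simp add: field_simps)
  then have "0 \<le> 2 * pi * of_int m / real n" using next_point_ge[OF t j] by simp
  then have "0 \<le> m"
    using mult_le_cancel_left_pos[of "2 * pi / real n" 0 "of_int m"] \<open>n \<ge> 1\<close> by simp
  moreover have "m \<noteq> 0"
  proof
    assume "m = 0"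
    then have "cis (t j') = cis (t j)" using m cis_next by simp
    then show False
      using reg inj_onD[of "\<lambda>j. cis (t j)" "{1..n}" j' j] j j'
      unfolding distinct_equally_spaced_def by blast
  qed
  ultimately have "1 \<le> m" by simp
  then have "1 * pi \<le> 2 * of_int m * pi" by (intro mult_right_mono) auto
  then have "pi / real n \<le> next_point n t j - t j"
    unfolding m by (intro divide_right_mono) (simp_all add: mult_ac)
  then show ?thesis by simp
qed

locale circle_kernel =
  fixes g :: "real \<Rightarrow> ereal"
  assumes pos: "0 < g t"
    and even: "g (- t) = g t"
    and periodic: "g (t + 2 * pi) = g t"
    and tendsto_0: "(g \<longlongrightarrow> g 0) (at 0)"
    and antimono: "antimono_on {0<..pi} g"
    and strictly_convex: "strictly_convex_on {0<..pi} g"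
begin

section \<open>Symmetry, finiteness and strict convexity of the kernel\<close>

lemma periodic_int: "g (t + 2 * pi * of_int k) = g t"
proof (induction k rule: int_induct[where k = 0])
  case base
  show ?case by simp
next
  case (step1 i)
  have "g (t + 2 * pi * of_int (i + 1)) = g (t + 2 * pi * of_int i + 2 * pi)"
    by (simp add: algebra_simps)
  then show ?case using step1 periodic by metis
next
  case (step2 i)
  have "g (t + 2 * pi * of_int i) = g (t + 2 * pi * of_int (i - 1) + 2 * pi)"
    by (simp add: algebra_simps)
  then show ?case using step2 periodic by metis
qed

lemma cis_eq_imp_eq: "cis x = cis y \<Longrightarrow> g x = g y"
  using sin_cos_eq_iff[of x y] periodic_int by (auto simp: complex_eq_iff)

lemma reflect: "g (2 * pi - t) = g t"
  using periodic[of "-t"] even[of t] by simp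

text \<open>Where \<open>g\<close> is infinite, possibly at multiples of \<open>2 * pi\<close>,
  \<open>f\<close> takes the default value 0; it is compared with \<open>g\<close> only inside
  \<open>(0, 2 * pi)\<close>.\<close>

definition f :: "real \<Rightarrow> real" where "f x = real_of_ereal (g x)"

lemma f_reflect: "f (2 * pi - t) = f t"
  by (simp add: f_def reflect)

text \<open>The strict convexity inequality excludes an infinite value at an interior point, and
  monotonicity carries finiteness to the right, up to \<open>pi\<close>.\<close>

lemma g_eq_f_half:
  assumes "0 < x" "x \<le> pi"
  shows "g x = ereal (f x)"
proof -
  \<comment> \<open>The cap \<open>pi / 2\<close> keeps \<open>3 * y / 2\<close> inside
    \<open>(0, pi]\<close>, so that \<open>y\<close> is the midpoint of two admissible
    points.\<close>
  define y where "y = min x (pi / 2)"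
  have y: "0 < y" "y \<le> pi / 2" "y \<le> x" using assms by (auto simp: y_def)
  have "y/2 \<in> {0<..pi}" "3*y/2 \<in> {0<..pi}" "y/2 \<noteq> 3*y/2" using y by auto
  moreover have "(0::real) < 1/2" "(1/2::real) < 1" by auto
  ultimately have "g ((1 - 1/2) * (y/2) + 1/2 * (3*y/2))
      < ereal (1 - 1/2) * g (y/2) + ereal (1/2) * g (3*y/2)"
    using strictly_convex unfolding strictly_convex_on_def by blast
  then have "g y < \<infinity>" by (auto simp: field_simps)
  moreover have "g x \<le> g y"
    using antimono assms y by (auto simp: monotone_on_def)
  ultimately show ?thesis using pos[of x] unfolding f_def by (cases "g x") auto
qed

lemma g_eq_f:
  assumes "0 < x" "x < 2 * pi"
  shows "g x = ereal (f x)"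
proof (cases "x \<le> pi")
  case False
  then show ?thesis using g_eq_f_half[of "2 * pi - x"] assms by (simp add: reflect f_reflect)
qed (use g_eq_f_half assms in auto)

lemma f_strict_half:
  assumes "x \<in> {0<..pi}" "y \<in> {0<..pi}" "x \<noteq> y" "0 < u" "u < 1"
  shows "f ((1 - u) * x + u * y) < (1 - u) * f x + u * f y"
proof -
  have "convex {0<..pi}" by simp
  then have "(1 - u) * x + u * y \<in> {0<..pi}"
    using assms convexD_alt[of "{0<..pi}" x y u] by auto
  moreover have "g ((1 - u) * x + u * y) < ereal (1 - u) * g x + ereal u * g y"
    using strictly_convex assms unfolding strictly_convex_on_def by blast
  ultimately show ?thesis using assms by (simp add: g_eq_f_half)
qed

lemma f_antimono:
  assumes "0 < x" "x \<le> y" "y \<le> pi"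
  shows "f y \<le> f x"
proof -
  have "g y \<le> g x" using antimono assms by (auto simp: monotone_on_def)
  then show ?thesis using assms by (simp add: g_eq_f_half)
qed

text \<open>The value at the midpoint is at least \<open>f y\<close> and strictly below the average
  of \<open>f x\<close> and \<open>f y\<close>.\<close>

lemma f_strict_antimono:
  assumes "0 < x" "x < y" "y \<le> pi"
  shows "f y < f x"
proof -
  have "f ((1 - 1/2) * x + 1/2 * y) < (1 - 1/2) * f x + 1/2 * f y"
    using assms by (intro f_strict_half) auto
  moreover have "f y \<le> f ((1 - 1/2) * x + 1/2 * y)"
    using assms by (intro f_antimono) auto
  ultimately show ?thesis by simp
qed

text \<open>The map \<open>a\<close> folds \<open>(0, 2 * pi)\<close> onto \<open>(0, pi]\<close>
  and preserves \<open>f\<close>. It is concave, and a non-increasing convex function of a concave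
  one is convex; only strictness requires two cases.\<close>

lemma f_strict:
  assumes "x \<in> {0<..<2*pi}" "y \<in> {0<..<2*pi}" "x \<noteq> y" "0 < u" "u < 1"
  shows "f ((1 - u) * x + u * y) < (1 - u) * f x + u * f y"
proof -
  define a where "a z = pi - \<bar>z - pi\<bar>" for z :: real
  have fa: "f (a z) = f z" for z
    using f_reflect[of z] by (auto simp: a_def abs_if)
  have a_range: "a z \<in> {0<..pi}" if "z \<in> {0<..<2*pi}" for z
    using that by (auto simp: a_def)
  define z where "z = (1 - u) * x + u * y"
  have z: "z \<in> {0<..<2*pi}"
    using convexD_alt[of "{0<..<2*pi}" x y u] assms by (auto simp: z_def)
  have zpi: "z - pi = (1 - u) * (x - pi) + u * (y - pi)"
    by (simp add: z_def algebra_simps)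
  show ?thesis
  proof (cases "a x = a y")
    case False
    have "\<bar>z - pi\<bar> \<le> (1 - u) * \<bar>x - pi\<bar> + u * \<bar>y - pi\<bar>"
      unfolding zpi using assms abs_triangle_ineq[of "(1 - u) * (x - pi)" "u * (y - pi)"]
      by (simp add: abs_mult)
    then have "(1 - u) * a x + u * a y \<le> a z" by (simp add: a_def algebra_simps)
    moreover have "(1 - u) * a x + u * a y \<in> {0<..pi}"
      using convexD_alt[of "{0<..pi}" "a x" "a y" u] a_range assms by auto
    ultimately have "f (a z) \<le> f ((1 - u) * a x + u * a y)"
      using a_range[OF z] by (intro f_antimono) auto
    also have "\<dots> < (1 - u) * f (a x) + u * f (a y)"
      using False a_range assms by (intro f_strict_half) auto
    finally show ?thesis by (simp add: fa z_def)
  next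
    \<comment> \<open>Now \<open>x\<close> and \<open>y\<close> are mirror images about
      \<open>pi\<close>, so \<open>z\<close> is strictly closer to \<open>pi\<close> than both, and
      strict monotonicity applies.\<close>
    case True
    then have y: "y - pi = - (x - pi)" and x: "x - pi \<noteq> 0"
      using assms by (auto simp: a_def abs_if split: if_splits)
    have "z - pi = (1 - 2 * u) * (x - pi)"
      unfolding zpi y by (simp add: algebra_simps)
    then have "\<bar>z - pi\<bar> = \<bar>1 - 2 * u\<bar> * \<bar>x - pi\<bar>" by (simp add: abs_mult)
    also have "\<dots> < 1 * \<bar>x - pi\<bar>"
      using assms x by (intro mult_strict_right_mono) auto
    finally have "f (a z) < f (a x)"
      using a_range[OF z] a_range[OF assms(1)] by (intro f_strict_antimono) (auto simp: a_def)
    moreover have "f y = f x" using True fa by metis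
    ultimately show ?thesis by (simp add: fa z_def algebra_simps)
  qed
qed

lemma f_convex: "convex_on {0<..<2*pi} f"
proof (rule convex_onI)
  fix u x y :: real
  assume "0 < u" "u < 1" "x \<in> {0<..<2*pi}" "y \<in> {0<..<2*pi}"
  then show "f ((1 - u) *\<^sub>R x + u *\<^sub>R y) \<le> (1 - u) * f x + u * f y"
    using f_strict[of x y u] by (cases "x = y") (auto simp: algebra_simps)
qed simp

text \<open>After reduction modulo \<open>2 * pi\<close>, the limit hypothesis handles 0 and
  convexity on an open interval handles the rest.\<close>

lemma continuous: "continuous_on UNIV g"
  unfolding continuous_on_eq_continuous_at[OF open_UNIV]
proof
  fix x :: real
  define k where "k = \<lfloor>x / (2 * pi)\<rfloor>"
  define r where "r = x - 2 * pi * of_int k"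
  have "of_int k \<le> x / (2 * pi)" "x / (2 * pi) < of_int k + 1"
    by (auto simp: k_def)
  then have r: "0 \<le> r" "r < 2 * pi"
    by (auto simp: r_def field_simps)
  have "isCont g r"
  proof (cases "r = 0")
    case True
    then show ?thesis using tendsto_0 by (simp add: isCont_def)
  next
    case False
    have "continuous_on {0<..<2*pi} f"
      using f_convex by (intro convex_on_continuous) auto
    then have "continuous_on {0<..<2*pi} (\<lambda>x. ereal (f x))"
      by (intro continuous_on_ereal)
    then have "continuous_on {0<..<2*pi} g"
      by (rule continuous_on_eq) (simp add: g_eq_f)
    then show ?thesis using r False by (auto simp: continuous_on_eq_continuous_at)
  qed
  then have "isCont (\<lambda>y. g (y - 2 * pi * of_int k)) x"
    unfolding r_def by (intro isCont_o2[of x "\<lambda>y. y - 2 * pi * of_int k" g] continuous_intros)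
  moreover have "g (y - 2 * pi * of_int k) = g y" for y
    using periodic_int[of y "- k"] by simp
  ultimately show "isCont g x" by simp
qed

section \<open>Tangent lines, including the end points of \<open>[0, 2 * pi]\<close>\<close>

lemma g_0_ge:
  assumes "x \<in> {0<..<2*pi}" and "\<And>y. y \<in> {0<..<2*pi} \<Longrightarrow> f x + c * (y - x) \<le> f y"
  shows "ereal (f x + c * (0 - x)) \<le> g 0"
proof (rule tendsto_le[of "at_right 0"])
  show "(g \<longlongrightarrow> g 0) (at_right 0)"
    using tendsto_0 by (rule filterlim_mono) (auto simp: at_le)
  show "((\<lambda>y. ereal (f x + c * (y - x))) \<longlongrightarrow> ereal (f x + c * (0 - x))) (at_right 0)"
    by (intro tendsto_intros)
  have "eventually (\<lambda>y. y \<in> {0<..<2*pi}) (at_right (0::real))"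
    by (rule eventually_at_right_real) simp
  then show "\<forall>\<^sub>F y in at_right 0. ereal (f x + c * (y - x)) \<le> g y"
    by eventually_elim (use assms in \<open>auto simp: g_eq_f\<close>)
qed simp

lemma subgradient_interior:
  assumes "x \<in> {0<..<2*pi}"
  shows "\<exists>c. \<forall>y\<in>{0<..<2*pi}. f x + c * (y - x) \<le> f y"
proof (intro exI ballI)
  fix y assume "y \<in> {0<..<2*pi}"
  \<comment> \<open>The slope is the right derivative of \<open>f\<close> at \<open>x\<close>,
    written as the infimum of the difference quotients to the right.\<close>
  then show "f x + Inf ((\<lambda>t. (f x - f t) / (x - t)) ` ({x<..} \<inter> {0<..<2*pi})) * (y - x) \<le> f y"
    using convex_le_Inf_differential[OF f_convex, of x y] assms
    by (simp add: interior_open)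
qed

lemma f_midpoint:
  assumes "x \<in> {0<..<2*pi}" "y \<in> {0<..<2*pi}" "x \<noteq> y"
  shows "2 * f ((x + y) / 2) < f x + f y"
  using f_strict[OF assms, of "1/2"] by (simp add: field_simps)

text \<open>At interior \<open>y\<close>, strict midpoint convexity and the tangent bound at the
  midpoint suffice. At the end points passing to the limit loses strictness, which has to be
  recovered.\<close>

lemma subgradient_strict:
  assumes x: "x \<in> {0<..<2*pi}" and c: "\<And>y. y \<in> {0<..<2*pi} \<Longrightarrow> f x + c * (y - x) \<le> f y"
    and y: "y \<in> {0..2*pi}" "y \<noteq> x"
  shows "ereal (f x + c * (y - x)) < g y"
proof -
  have zero: "ereal (f x + c * (0 - x)) < g 0"
    if x: "x \<in> {0<..<2*pi}" and c: "\<And>y. y \<in> {0<..<2*pi} \<Longrightarrow> f x + c * (y - x) \<le> f y" for x c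
  proof -
    \<comment> \<open>The tangent at \<open>x/2\<close> yields
      \<open>g 0 \<ge> 2 * f (x/2) - f x\<close>, and the midpoint \<open>3*x/4\<close> shows that
      \<open>f (x/2)\<close> is strictly above the tangent at \<open>x\<close>; together these make
      the bound at 0 strict.\<close>
    obtain d where d: "\<And>y. y \<in> {0<..<2*pi} \<Longrightarrow> f (x/2) + d * (y - x/2) \<le> f y"
      using subgradient_interior[of "x/2"] x by fastforce
    have "ereal (f (x/2) + d * (0 - x/2)) \<le> g 0"
      using x d by (intro g_0_ge) auto
    moreover have "f x + c * (3*x/4 - x) \<le> f (3*x/4)" "f x + c * (x/2 - x) \<le> f (x/2)"
      using c[of "3*x/4"] c[of "x/2"] x by auto
    moreover have "2 * f (3*x/4) < f x + f (x/2)"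
      using f_midpoint[of x "x/2"] x by (simp add: field_simps)
    moreover have "f (x/2) + d * (x - x/2) \<le> f x"
      using d[of x] x by auto
    ultimately show ?thesis
      by (cases "g 0") (auto simp: algebra_simps)
  qed
  consider "y = 0" | "y = 2 * pi" | "y \<in> {0<..<2*pi}" using y by fastforce
  then show ?thesis
  proof cases
    case 1
    then show ?thesis using zero x c by simp
  next
    case 2
    \<comment> \<open>Reflection about \<open>pi\<close> moves the end point \<open>2 * pi\<close>
      to 0 and reverses the sign of the slope.\<close>
    have "ereal (f (2*pi - x) + (- c) * (0 - (2*pi - x))) < g 0"
    proof (rule zero)
      fix y assume "y \<in> {0<..<2*pi}"
      then have "f x + c * (2*pi - y - x) \<le> f y"
        using c[of "2*pi - y"] by (simp add: f_reflect)
      then show "f (2*pi - x) + (- c) * (y - (2*pi - x)) \<le> f y"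
        unfolding f_reflect by (simp add: algebra_simps)
    qed (use x in auto)
    then have "ereal (f x + c * (2*pi - x)) < g 0" unfolding f_reflect by (simp add: algebra_simps)
    then show ?thesis using 2 reflect[of 0] by simp
  next
    case 3
    have "f x + c * ((x + y) / 2 - x) \<le> f ((x + y) / 2)"
      using x 3 by (intro c) auto
    then show ?thesis using f_midpoint[OF x 3] y 3 by (simp add: g_eq_f field_simps)
  qed
qed

text \<open>Antisymmetry about \<open>pi\<close> can be arranged because \<open>g\<close> is symmetric about \<open>pi\<close>.\<close>

lemma antisymmetric_subgradient:
  obtains c where "\<And>x. c (2 * pi - x) = - c x"
    and "\<And>x y. x \<in> {0<..<2*pi} \<Longrightarrow> y \<in> {0..2*pi} \<Longrightarrow> y \<noteq> x \<Longrightarrow>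
      ereal (f x + c x * (y - x)) < g y"
proof -
  obtain d where d: "\<And>x y. x \<in> {0<..<2*pi} \<Longrightarrow> y \<in> {0<..<2*pi} \<Longrightarrow> f x + d x * (y - x) \<le> f y"
    using subgradient_interior by metis
  \<comment> \<open>By symmetry \<open>- d (2 * pi - x)\<close> is also a slope of a supporting line
    at \<open>x\<close>, and so is its average with \<open>d x\<close>.\<close>
  define c where "c x = (d x - d (2 * pi - x)) / 2" for x
  have "f x + c x * (y - x) \<le> f y" if "x \<in> {0<..<2*pi}" "y \<in> {0<..<2*pi}" for x y
  proof -
    have "f x + d (2*pi - x) * (x - y) \<le> f y"
      using d[of "2*pi - x" "2*pi - y"] that by (simp add: f_reflect)
    then show ?thesis using d[OF that] by (simp add: c_def field_simps)
  qed
  then show ?thesis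
    by (intro that[of c] subgradient_strict) (auto simp: c_def field_simps)
qed

section \<open>The potential: continuity, attained minima, cyclic renumbering\<close>

text \<open>Addition on \<open>ereal\<close> is discontinuous only where opposite infinities meet;
  positivity of \<open>g\<close> rules this out.\<close>

lemma potential_continuous: "continuous_on UNIV (potential g n t)"
proof -
  have "continuous_on UNIV (\<lambda>s. \<Sum>j\<in>A. g (s - t j))" if "finite A" for A :: "nat set"
    using that
  proof (induction A rule: finite_induct)
    case (insert a A)
    have "continuous_on UNIV (\<lambda>s. g (s - t a) + (\<Sum>j\<in>A. g (s - t j)))"
      unfolding continuous_on_def
    proof
      fix s :: real
      have "0 \<le> (\<Sum>j\<in>A. g (s - t j))" using pos by (intro sum_nonneg) (simp add: less_imp_le)
      moreover have "((\<lambda>s. g (s - t a)) \<longlongrightarrow> g (s - t a)) (at s)"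
      proof -
        have "isCont g (s - t a)"
          using continuous by (simp add: continuous_on_eq_continuous_at)
        then have "isCont (\<lambda>s. g (s - t a)) s"
          by (intro isCont_o2[of s "\<lambda>s. s - t a" g] continuous_intros)
        then show ?thesis by (simp add: isCont_def)
      qed
      moreover have "((\<lambda>s. \<Sum>j\<in>A. g (s - t j)) \<longlongrightarrow> (\<Sum>j\<in>A. g (s - t j))) (at s)"
        using insert.IH by (simp add: continuous_on_def)
      ultimately show "((\<lambda>s. g (s - t a) + (\<Sum>j\<in>A. g (s - t j))) \<longlongrightarrow>
          g (s - t a) + (\<Sum>j\<in>A. g (s - t j))) (at s)"
        using pos[of "s - t a"] by (intro tendsto_add_ereal_general) auto
    qed
    then show ?case using insert.hyps by simp
  qed simp
  then show ?thesis unfolding potential_def by simp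
qed

lemma arc_min_attained:
  assumes "t j \<le> next_point n t j"
  obtains s where "s \<in> {t j..next_point n t j}" "potential g n t s = arc_min g n t j"
proof -
  obtain s where "s \<in> {t j..next_point n t j}"
      "\<And>r. r \<in> {t j..next_point n t j} \<Longrightarrow> potential g n t s \<le> potential g n t r"
    using continuous_attains_inf[of "{t j..next_point n t j}" "potential g n t"] assms
      continuous_on_subset[OF potential_continuous] by auto
  then show ?thesis
    by (intro that[of s]) (auto simp: arc_min_def intro!: antisym INF_greatest INF_lower2)
qed

definition optimum :: "nat \<Rightarrow> ereal" where
  "optimum n = (\<Sum>i=1..n. g (node n i))"

lemma optimum_eq: "optimum n = ereal (\<Sum>i=1..n. f (node n i))"
  unfolding optimum_def sum_ereal[symmetric]
  by (rule sum.cong) (use node_range in \<open>auto intro!: g_eq_f\<close>)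

text \<open>Renumbers the points so that the summation starts just after the \<open>j\<close>-th
  arc.\<close>

lemma potential_lift:
  assumes "j \<in> {1..n}"
  shows "potential g n t s = (\<Sum>i=1..n. g (lift n t (j + i) - s))"
proof -
  have "g (lift n t (k + n) - s) = g (lift n t k - s)" if "1 \<le> k" "k \<le> j" for k
    using that assms periodic[of "t k - s"] by (simp add: lift_def algebra_simps)
  then have "(\<Sum>i=1..n. g (lift n t (j + i) - s)) = (\<Sum>i=1..n. g (lift n t i - s))"
    using assms by (intro sum_cyclic_shift) auto
  also have "\<dots> = potential g n t s"
    unfolding potential_def
  proof (rule sum.cong)
    fix i assume "i \<in> {1..n}"
    then show "g (lift n t i - s) = g (s - t i)" using even[of "s - t i"] by (simp add: lift_def)
  qed simp
  finally show ?thesis ..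
qed

section \<open>The lower bound on a suitable arc and its equality case\<close>

lemma ex_good_arc:
  assumes "n \<ge> 1" and t: "t \<in> Omega n"
  obtains j where "j \<in> {1..n}"
    and "\<And>s. s \<in> {t j..next_point n t j} \<Longrightarrow> optimum n \<le> potential g n t s"
    and "\<And>s i. s \<in> {t j..next_point n t j} \<Longrightarrow> potential g n t s \<le> optimum n \<Longrightarrow> i \<in> {1..n} \<Longrightarrow>
      lift n t (j + i) = s + node n i"
proof -
  obtain c where c_refl: "\<And>x. c (2 * pi - x) = - c x"
    and c: "\<And>x y. x \<in> {0<..<2*pi} \<Longrightarrow> y \<in> {0..2*pi} \<Longrightarrow> y \<noteq> x \<Longrightarrow>
      ereal (f x + c x * (y - x)) < g y"
    using antisymmetric_subgradient by blast
  \<comment> \<open>\<open>q\<close> is periodic in \<open>k\<close>; this makes the average over \<open>j\<close> vanish.\<close>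
  define q where "q k = lift n t k - 2 * pi * real k / real n" for k
  \<comment> \<open>Reversing the order of summation shows that the sum equals its own
    negative.\<close>
  have "(\<Sum>i=1..n. c (node n i)) = (\<Sum>i=1..n. c (node n (n + 1 - i)))"
    by (rule sum.atLeastAtMost_rev)
  also have "\<dots> = (\<Sum>i=1..n. - c (node n i))"
    by (rule sum.cong) (simp_all only: node_reflect c_refl)
  finally have c_sum: "(\<Sum>i=1..n. c (node n i)) = 0" by (simp add: sum_negf)
  have "(\<Sum>j=1..n. \<Sum>i=1..n. c (node n i) * q (j + i)) =
      (\<Sum>i=1..n. c (node n i) * (\<Sum>j=1..n. q (i + j)))"
    by (subst sum.swap) (simp add: sum_distrib_left add.commute)
  also have "\<dots> = (\<Sum>i=1..n. c (node n i) * (\<Sum>j=1..n. q j))"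
  proof (rule sum.cong)
    fix i assume i: "i \<in> {1..n}"
    have "q (k + n) = q k" if "1 \<le> k" "k \<le> i" for k
      using that i by (simp add: q_def lift_def field_simps)
    then have "(\<Sum>j=1..n. q (i + j)) = (\<Sum>j=1..n. q j)"
      using assms by (intro sum_cyclic_shift) auto
    then show "c (node n i) * (\<Sum>j=1..n. q (i + j)) = c (node n i) * (\<Sum>j=1..n. q j)" by simp
  qed simp
  also have "\<dots> = 0" using c_sum by (simp flip: sum_distrib_right)
  finally have q_sum: "(\<Sum>j=1..n. \<Sum>i=1..n. c (node n i) * q (j + i)) = 0" .
  have "\<exists>j\<in>{1..n}. 0 \<le> (\<Sum>i=1..n. c (node n i) * q (j + i))"
  proof (rule ccontr)
    assume "\<not> ?thesis"
    then have "(\<Sum>j=1..n. \<Sum>i=1..n. c (node n i) * q (j + i)) < (\<Sum>j=1..n. 0)"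
      using assms by (intro sum_strict_mono) (auto simp: not_le)
    then show False using q_sum by simp
  qed
  then obtain j where j: "j \<in> {1..n}" and good: "0 \<le> (\<Sum>i=1..n. c (node n i) * q (j + i))" ..
  define tangent where
    "tangent s i = f (node n i) + c (node n i) * (lift n t (j + i) - s - node n i)" for s i
  have optimum_le: "optimum n \<le> ereal (\<Sum>i=1..n. tangent s i)" for s
  proof -
    \<comment> \<open>The difference between \<open>lift n t (j + i) - s - node n i\<close> and
      \<open>q (j + i)\<close>. It is the same for all \<open>i\<close>, so the vanishing slope sum
      removes it, and \<open>s\<close> with it.\<close>
    define d where "d = (2 * real j + 1) * pi / real n - s"
    have "(\<Sum>i=1..n. tangent s i) = (\<Sum>i=1..n. f (node n i) + c (node n i) * q (j + i) + d * c (node n i))"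
      using assms by (intro sum.cong) (auto simp: tangent_def q_def d_def node_def field_simps)
    also have "\<dots> = (\<Sum>i=1..n. f (node n i)) + (\<Sum>i=1..n. c (node n i) * q (j + i))"
      using c_sum by (simp add: sum.distrib flip: sum_distrib_left)
    finally show ?thesis using good by (simp add: optimum_eq)
  qed
  have less: "ereal (tangent s i) < g (lift n t (j + i) - s)"
    if "s \<in> {t j..next_point n t j}" "i \<in> {1..n}" "lift n t (j + i) - s \<noteq> node n i" for s i
    unfolding tangent_def using c[OF node_range[OF that(2)] lift_range[OF t j that(2,1)] that(3)] .
  have le: "ereal (tangent s i) \<le> g (lift n t (j + i) - s)"
    if "s \<in> {t j..next_point n t j}" "i \<in> {1..n}" for s i
    using less[OF that] node_range[OF that(2)]
    by (cases "lift n t (j + i) - s = node n i") (auto simp: tangent_def g_eq_f)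
  show ?thesis
  proof (rule that[OF j])
    fix s assume s: "s \<in> {t j..next_point n t j}"
    have "ereal (\<Sum>i=1..n. tangent s i) \<le> potential g n t s"
      unfolding potential_lift[OF j] sum_ereal[symmetric] by (rule sum_mono) (rule le[OF s])
    with optimum_le show "optimum n \<le> potential g n t s" by (rule order_trans)
    fix i assume small: "potential g n t s \<le> optimum n" and i: "i \<in> {1..n}"
    show "lift n t (j + i) = s + node n i"
    proof (rule ccontr)
      assume "\<not> ?thesis"
      then have "ereal (tangent s i) < g (lift n t (j + i) - s)" using less[OF s i] by auto
      then have "ereal (\<Sum>i=1..n. tangent s i) < potential g n t s"
        unfolding potential_lift[OF j] by (intro sum_ereal_strict_mono[OF _ le[OF s] i]) auto
      then show False using small optimum_le[of s] by auto
    qed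
  qed
qed

section \<open>The potential of a regular configuration\<close>

text \<open>Seen from \<open>t j + pi / n\<close>, the vertices lie, modulo \<open>2 * pi\<close>,
  at the nodes in some order.\<close>

lemma potential_regular:
  assumes "n \<ge> 1" and reg: "distinct_equally_spaced n t" and j: "j \<in> {1..n}"
  shows "potential g n t (t j + pi / real n) = optimum n"
proof -
  obtain \<alpha> \<kappa> where bij: "bij_betw \<kappa> {1..n} {..<n}"
    and \<kappa>: "\<And>j. j \<in> {1..n} \<Longrightarrow> cis (t j) = cis (\<alpha> + 2 * pi * real (\<kappa> j) / real n)"
    by (rule distinct_equally_spacedE[OF reg]) (rule that)
  \<comment> \<open>The constant 3 makes \<open>h (Suc (\<kappa> j) + i)\<close> equal to
    \<open>g (node n i)\<close>, while \<open>Suc\<close> moves the vertex numbers from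
    \<open>{..<n}\<close> to \<open>{1..n}\<close>.\<close>
  define h where "h i = g ((2 * real i - 2 * real (\<kappa> j) - 3) * pi / real n)" for i
  have "potential g n t (t j + pi / real n) = (\<Sum>i=1..n. h (Suc (\<kappa> i)))"
    unfolding potential_def
  proof (rule sum.cong)
    fix i assume i: "i \<in> {1..n}"
    have "cis (t j + pi / real n - t i) = cis (t j) * cis (pi / real n) / cis (t i)"
      by (simp add: cis_mult cis_divide)
    also have "\<dots> = cis (- ((2 * real (Suc (\<kappa> i)) - 2 * real (\<kappa> j) - 3) * pi / real n))"
      unfolding \<kappa>[OF i] \<kappa>[OF j] cis_mult cis_divide
      by (rule arg_cong[where f = cis]) (use \<open>n \<ge> 1\<close> in \<open>simp add: field_simps\<close>)
    finally have "g (t j + pi / real n - t i)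
        = g (- ((2 * real (Suc (\<kappa> i)) - 2 * real (\<kappa> j) - 3) * pi / real n))"
      by (rule cis_eq_imp_eq)
    then show "g (t j + pi / real n - t i) = h (Suc (\<kappa> i))"
      unfolding h_def even .
  qed simp
  also have "\<dots> = (\<Sum>k<n. h (Suc k))"
    by (rule sum.reindex_bij_betw[OF bij])
  also have "\<dots> = (\<Sum>i=1..n. h i)"
    by (simp add: sum.atLeast1_atMost_eq)
  also have "\<dots> = (\<Sum>i=1..n. h (Suc (\<kappa> j) + i))"
  proof (rule sum_cyclic_shift[symmetric])
    fix k
    have "(2 * real (k + n) - 2 * real (\<kappa> j) - 3) * pi / real n
        = (2 * real k - 2 * real (\<kappa> j) - 3) * pi / real n + 2 * pi"
      using \<open>n \<ge> 1\<close> by (simp add: field_simps)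
    then show "h (k + n) = h k" unfolding h_def by (simp only: periodic)
  qed (use assms in auto)
  also have "\<dots> = optimum n"
    by (simp add: h_def optimum_def node_def algebra_simps)
  finally show ?thesis .
qed

section \<open>The optimal value and the minimizers\<close>

lemma arc_min_le_max_arc_min: "j \<in> {1..n} \<Longrightarrow> arc_min g n t j \<le> max_arc_min g n t"
  unfolding max_arc_min_def by (intro Max_ge) auto

lemma optimum_le_max_arc_min:
  assumes "n \<ge> 1" "t \<in> Omega n"
  shows "optimum n \<le> max_arc_min g n t"
proof (rule ex_good_arc[OF assms])
  fix j assume j: "j \<in> {1..n}"
    and le: "\<And>s. s \<in> {t j..next_point n t j} \<Longrightarrow> optimum n \<le> potential g n t s"
  have "optimum n \<le> arc_min g n t j" unfolding arc_min_def by (rule INF_greatest) (rule le)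
  also have "\<dots> \<le> max_arc_min g n t" using j by (rule arc_min_le_max_arc_min)
  finally show ?thesis .
qed

lemma max_arc_min_regular_le:
  assumes "n \<ge> 1" "t \<in> Omega n" "distinct_equally_spaced n t"
  shows "max_arc_min g n t \<le> optimum n"
proof -
  have "arc_min g n t j \<le> optimum n" if "j \<in> {1..n}" for j
    unfolding arc_min_def
    using regular_arc_midpoint[OF assms that] potential_regular[OF assms(1,3) that]
    by (intro INF_lower2[of "t j + pi / real n"]) auto
  then show ?thesis using assms(1) unfolding max_arc_min_def by (subst Max_le_iff) auto
qed

text \<open>On the good arc the minimum is attained at some \<open>s\<close> and cannot exceed
  \<open>optimum n\<close>, so the equality case fixes all \<open>n\<close> points relative to
  \<open>s\<close>.\<close>

lemma regular_if_max_arc_min_le: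
  assumes "n \<ge> 1" and t: "t \<in> Omega n" and le: "max_arc_min g n t \<le> optimum n"
  shows "distinct_equally_spaced n t"
proof (rule ex_good_arc[OF assms(1,2)])
  fix j assume j: "j \<in> {1..n}" and eq:
    "\<And>s i. s \<in> {t j..next_point n t j} \<Longrightarrow> potential g n t s \<le> optimum n \<Longrightarrow> i \<in> {1..n} \<Longrightarrow>
      lift n t (j + i) = s + node n i"
  obtain s where s: "s \<in> {t j..next_point n t j}" "potential g n t s = arc_min g n t j"
    using arc_min_attained[OF next_point_ge[OF t j]] .
  have "potential g n t s \<le> optimum n"
    using order_trans[OF arc_min_le_max_arc_min[OF j] le] s(2) by simp
  note eq = eq[OF s(1) this]
  show ?thesis
  \<comment> \<open>The first node is \<open>pi / n\<close>, so the polygon starts at angle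
    \<open>s + pi / n\<close>.\<close>
  proof (rule distinct_equally_spacedI[OF assms(1), of "s + pi / real n"])
    fix k assume k: "k < n"
    have "s + pi / real n + 2 * pi * real k / real n = lift n t (j + Suc k)"
      using eq[of "Suc k"] k by (simp add: node_def field_simps)
    moreover have "cis (lift n t (j + Suc k)) \<in> (\<lambda>j. cis (t j)) ` {1..n}"
    proof (cases "j + Suc k \<le> n")
      case True
      then show ?thesis by (auto simp: lift_def)
    next
      case False
      then show ?thesis using j k
        by (intro image_eqI[where x = "j + Suc k - n"]) (auto simp: lift_def simp flip: cis_mult)
    qed
    ultimately show "cis (s + pi / real n + 2 * pi * real k / real n) \<in> (\<lambda>j. cis (t j)) ` {1..n}"
      by simp
  qed
qed

end

text \<open>The first conjunct justifies reading the infimum in \<open>arc_min\<close> as a minimum;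
  the last allows arbitrary rotations of the polygon.\<close>

theorem theorem2p1:
  fixes n :: nat and g :: "real \<Rightarrow> ereal"
  assumes "n \<ge> 1"
    and "\<And>t. 0 < g t"
    and "\<And>t. g (- t) = g t"
    and "\<And>t. g (t + 2 * pi) = g t"
    and "(g \<longlongrightarrow> g 0) (at 0)"
    and "antimono_on {0<..pi} g"
    and "strictly_convex_on {0<..pi} g"
  shows "(\<forall>t\<in>Omega n. \<forall>j\<in>{1..n}.
            \<exists>s\<in>{t j..next_point n t j}. potential g n t s = arc_min g n t j)
       \<and> is_arg_min (max_arc_min g n) (\<lambda>t. t \<in> Omega n) (equispaced n)
       \<and> (INF t\<in>Omega n. max_arc_min g n t) = potential g n (equispaced n) (pi / real n)
       \<and> (\<forall>t. is_arg_min (max_arc_min g n) (\<lambda>t. t \<in> Omega n) t \<longleftrightarrow>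
              t \<in> Omega n \<and> distinct_equally_spaced n t)"
proof -
  interpret circle_kernel g
    using assms by unfold_locales
  let ?V = "optimum n"
  note lower = optimum_le_max_arc_min[OF \<open>n \<ge> 1\<close>]
  note upper = max_arc_min_regular_le[OF \<open>n \<ge> 1\<close>]
  note regular = equispaced_distinct_equally_spaced[OF \<open>n \<ge> 1\<close>]
  have equi: "max_arc_min g n (equispaced n) = ?V"
    using lower upper equispaced_Omega regular by (simp add: antisym)
  have minimizer: "is_arg_min (max_arc_min g n) (\<lambda>t. t \<in> Omega n) t \<longleftrightarrow>
      t \<in> Omega n \<and> distinct_equally_spaced n t" for t
  proof
    assume "is_arg_min (max_arc_min g n) (\<lambda>t. t \<in> Omega n) t"
    then have "t \<in> Omega n" "max_arc_min g n t \<le> ?V"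
      using equispaced_Omega[of n] equi by (auto simp: is_arg_min_linorder)
    then show "t \<in> Omega n \<and> distinct_equally_spaced n t"
      using regular_if_max_arc_min_le[OF \<open>n \<ge> 1\<close>] by simp
  next
    assume "t \<in> Omega n \<and> distinct_equally_spaced n t"
    then show "is_arg_min (max_arc_min g n) (\<lambda>t. t \<in> Omega n) t"
      using lower upper by (auto simp: is_arg_min_linorder intro: order_trans)
  qed
  moreover have "(INF t\<in>Omega n. max_arc_min g n t) = potential g n (equispaced n) (pi / real n)"
  proof -
    have "(INF t\<in>Omega n. max_arc_min g n t) = ?V"
    proof (rule antisym)
      show "(INF t\<in>Omega n. max_arc_min g n t) \<le> ?V"
        using INF_lower[OF equispaced_Omega, of "max_arc_min g n" n] equi by simp
    qed (use lower in \<open>auto intro: INF_greatest\<close>)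
    \<comment> \<open>The first equally spaced point is 0, so the midpoint of its arc is
      \<open>pi / n\<close>.\<close>
    also have "\<dots> = potential g n (equispaced n) (pi / real n)"
      using potential_regular[OF \<open>n \<ge> 1\<close> regular, of 1] \<open>n \<ge> 1\<close> by (simp add: equispaced_def)
    finally show ?thesis .
  qed
  moreover have "\<exists>s\<in>{t j..next_point n t j}. potential g n t s = arc_min g n t j"
    if "t \<in> Omega n" "j \<in> {1..n}" for t j
    using arc_min_attained[OF next_point_ge[OF that]] by metis
  ultimately show ?thesis using equispaced_Omega[of n] regular by simp
qed

end
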